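(* Let $\Phi\subset\mathbb{R}^3$ be a skew ruled $C^3$-surface, parametrized by $\boldsymbol{x}(u,v)=\boldsymbol{s}(u)+v\,\boldsymbol{e}(u)$, $(u,v)\in I\times\mathbb{R}$, where $\boldsymbol{s}$ is the striction line, $\boldsymbol{e}$ is a unit vector field along the rulings and $u$ is the arclength of the spherical curve $\boldsymbol{e}$. Let $k$, $\delta$ be its conical curvature and parameter of distribution, and let $w=\sqrt{v^2+\delta(u)^2}$. Suppose that the normal curvature $k_N$ along the curves of constant striction distance (the curves $v=\text{constant}$) has the form $$k_N(u,v)=f(u)\,w^{n}\quad\text{for all }(u,v)\in I\times\mathbb{R},$$ for some integer $n\in\mathbb{Z}$ and some continuous function $f:I\to\mathbb{R}$. Then one of the following occurs: (a) $f=0$ (identically) and $\Phi$ is a right helicoid; (b) $n=-1$, $f(u)=-k(u)$ for all $u\in I$, and $\Phi$ is either an orthoid ruled surface of constant parameter of distribution or an Edlinger-surface.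
   Context: Setting. $I\subset\mathbb{R}$ is an open interval. A skew ruled $C^3$-surface $\Phi$ is a regular ruled surface of class $C^3$ without torsal rulings, parametrized on $I\times\mathbb{R}$ by $\boldsymbol{x}(u,v)=\boldsymbol{s}(u)+v\,\boldsymbol{e}(u)$ with $|\boldsymbol{e}|=1$, $|\boldsymbol{e}'|=1$ and $\langle\boldsymbol{s}',\boldsymbol{e}'\rangle=0$ on $I$ (so $\boldsymbol{s}$ is the striction line and $u$ is the arclength of $\boldsymbol{e}$); prime denotes $d/du$. Its invariants are: the conical curvature $k=(\boldsymbol{e},\boldsymbol{e}',\boldsymbol{e}'')$ and the parameter of distribution $\delta=(\boldsymbol{e},\boldsymbol{e}',\boldsymbol{s}')$ (both triple products), the striction $\sigma=\sphericalangle(\boldsymbol{e},\boldsymbol{s}')$ with $-\pi/2<\sigma\le\pi/2$ and $\operatorname{sign}\sigma=\operatorname{sign}\delta$, and $\lambda:=\cot\sigma$, so that $\boldsymbol{s}'=\delta\lambda\,\boldsymbol{e}+\delta\,\boldsymbol{e}\times\boldsymbol{e}'$. Skewness means $\delta(u)\neq0$ for all $u\in I$. The unit normal is $(\boldsymbol{x}_u\times\boldsymbol{x}_v)/|\boldsymbol{x}_u\times\boldsymbol{x}_v|$. The normal curvature at $(u,v)$ in direction $du:dv$ is $$k_N=\frac1w\cdot\frac{-[kv^2+\delta' v+\delta^2(k-\lambda)]\,du^2+2\delta\,du\,dv}{[v^2+\delta^2(\lambda^2+1)]\,du^2+2\delta\lambda\,du\,dv+dv^2}.$$ For the curves $v=\text{constant}$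 the direction is $dv=0$. An Edlinger-surface is a skew ruled surface whose osculating quadrics are rotational hyperboloids; a known necessary and sufficient condition, to be used as the definition, is $\delta'=0$ and $k\lambda+1=0$ on $I$. A ruled surface is orthoid if its rulings are perpendicular to the striction line, i.e. $\lambda=0$ on $I$. Constant parameter of distribution means $\delta'=0$ on $I$. A right helicoid is characterized by $k=\lambda=\delta'=0$ on $I$. *)

theory Defs
  imports "HOL-Analysis.Analysis"
begin

text \<open>Over a finite-dimensional domain, \<open>C\<^sup>k\<close> on an open set amounts to differentiability of the
  iterated directional derivatives of order below \<open>k\<close> and continuity of those of order \<open>k\<close>;
  this avoids derivatives with values in spaces of multilinear maps.\<close>

primrec class_C_on :: "nat \<Rightarrow> 'a::euclidean_space set \<Rightarrow> ('a \<Rightarrow> 'b::real_normed_vector) \<Rightarrow> bool" where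
  "class_C_on 0 S f \<longleftrightarrow> continuous_on S f"
| "class_C_on (Suc k) S f \<longleftrightarrow>
     (\<forall>p\<in>S. f differentiable (at p)) \<and>
     (\<forall>h. class_C_on k S (\<lambda>p. frechet_derivative f (at p) h))"

definition triple_product :: "real^3 \<Rightarrow> real^3 \<Rightarrow> real^3 \<Rightarrow> real" where
  "triple_product a b c = inner a (cross3 b c)"

definition partial_u :: "(real \<times> real \<Rightarrow> real^3) \<Rightarrow> real \<times> real \<Rightarrow> real^3" where
  "partial_u x p = frechet_derivative x (at p) (1, 0)"

definition partial_v :: "(real \<times> real \<Rightarrow> real^3) \<Rightarrow> real \<times> real \<Rightarrow> real^3" where
  "partial_v x p = frechet_derivative x (at p) (0, 1)"

definition regular_surface_on :: "(real \<times> real) set \<Rightarrow> (real \<times> real \<Rightarrow> real^3) \<Rightarrow> bool" where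
  "regular_surface_on U x \<longleftrightarrow> (\<forall>p\<in>U. cross3 (partial_u x p) (partial_v x p) \<noteq> 0)"

definition unit_normal :: "(real \<times> real \<Rightarrow> real^3) \<Rightarrow> real \<times> real \<Rightarrow> real^3" where
  "unit_normal x p =
     cross3 (partial_u x p) (partial_v x p) /\<^sub>R norm (cross3 (partial_u x p) (partial_v x p))"

definition first_form :: "(real \<times> real \<Rightarrow> real^3) \<Rightarrow> real \<times> real \<Rightarrow> real \<times> real \<Rightarrow> real" where
  "first_form x p d = (case d of (du, dv) \<Rightarrow>
     inner (partial_u x p) (partial_u x p) * du\<^sup>2
     + 2 * inner (partial_u x p) (partial_v x p) * du * dv
     + inner (partial_v x p) (partial_v x p) * dv\<^sup>2)"

definition second_form :: "(real \<times> real \<Rightarrow> real^3) \<Rightarrow> real \<times> real \<Rightarrow> real \<times> real \<Rightarrow> real" where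
  "second_form x p d = (case d of (du, dv) \<Rightarrow>
     inner (partial_u (partial_u x) p) (unit_normal x p) * du\<^sup>2
     + 2 * inner (partial_v (partial_u x) p) (unit_normal x p) * du * dv
     + inner (partial_v (partial_v x) p) (unit_normal x p) * dv\<^sup>2)"

definition normal_curvature :: "(real \<times> real \<Rightarrow> real^3) \<Rightarrow> real \<times> real \<Rightarrow> real \<times> real \<Rightarrow> real" where
  "normal_curvature x p d = second_form x p d / first_form x p d"

abbreviation curve_deriv :: "(real \<Rightarrow> real^3) \<Rightarrow> real \<Rightarrow> real^3" where
  "curve_deriv c u \<equiv> vector_derivative c (at u)"

definition ruled_param :: "(real \<Rightarrow> real^3) \<Rightarrow> (real \<Rightarrow> real^3) \<Rightarrow> real \<times> real \<Rightarrow> real^3" where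
  "ruled_param s e = (\<lambda>(u, v). s u + v *\<^sub>R e u)"

definition conical_curvature :: "(real \<Rightarrow> real^3) \<Rightarrow> real \<Rightarrow> real" where
  "conical_curvature e u = triple_product (e u) (curve_deriv e u) (curve_deriv (curve_deriv e) u)"

definition distribution_parameter :: "(real \<Rightarrow> real^3) \<Rightarrow> (real \<Rightarrow> real^3) \<Rightarrow> real \<Rightarrow> real" where
  "distribution_parameter s e u = triple_product (e u) (curve_deriv e u) (curve_deriv s u)"

text \<open>The angle between \<open>e\<close> and \<open>s'\<close>, carrying the sign of the parameter of distribution. It lies in
  \<open>(-\<pi>, \<pi>)\<close>. When \<open>\<langle>e, s'\<rangle> < 0\<close> it differs by \<open>\<pi>\<close> from a value in \<open>(-\<pi>/2, \<pi>/2]\<close>; such a shift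
  does not affect its cotangent, which is the only way the angle enters. On a skew surface with
  \<open>|e| = |e'| = 1\<close> and \<open>\<langle>s', e'\<rangle> = 0\<close> this is the sign for which
  \<open>s' = \<delta> \<lambda> e + \<delta> (e \<times> e')\<close> with \<open>\<lambda> = cot \<sigma>\<close>.\<close>

definition striction :: "(real \<Rightarrow> real^3) \<Rightarrow> (real \<Rightarrow> real^3) \<Rightarrow> real \<Rightarrow> real" where
  "striction s e u =
     sgn (distribution_parameter s e u) *
     arccos (inner (e u) (curve_deriv s u) / (norm (e u) * norm (curve_deriv s u)))"

definition cot_striction :: "(real \<Rightarrow> real^3) \<Rightarrow> (real \<Rightarrow> real^3) \<Rightarrow> real \<Rightarrow> real" where
  "cot_striction s e u = cot (striction s e u)"

definition skew_ruled_C3_surface ::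
    "real set \<Rightarrow> (real \<Rightarrow> real^3) \<Rightarrow> (real \<Rightarrow> real^3) \<Rightarrow> bool" where
  "skew_ruled_C3_surface I s e \<longleftrightarrow>
     open I \<and> is_interval I \<and> I \<noteq> {} \<and>
     class_C_on 3 (I \<times> UNIV) (ruled_param s e) \<and>
     regular_surface_on (I \<times> UNIV) (ruled_param s e) \<and>
     (\<forall>u\<in>I. norm (e u) = 1) \<and>
     (\<forall>u\<in>I. norm (curve_deriv e u) = 1) \<and>
     (\<forall>u\<in>I. inner (curve_deriv s u) (curve_deriv e u) = 0) \<and>
     (\<forall>u\<in>I. distribution_parameter s e u \<noteq> 0)"

definition constant_distribution_parameter ::
    "real set \<Rightarrow> (real \<Rightarrow> real^3) \<Rightarrow> (real \<Rightarrow> real^3) \<Rightarrow> bool" where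
  "constant_distribution_parameter I s e \<longleftrightarrow>
     (\<forall>u\<in>I. deriv (distribution_parameter s e) u = 0)"

definition orthoid :: "real set \<Rightarrow> (real \<Rightarrow> real^3) \<Rightarrow> (real \<Rightarrow> real^3) \<Rightarrow> bool" where
  "orthoid I s e \<longleftrightarrow> (\<forall>u\<in>I. orthogonal (e u) (curve_deriv s u))"

definition edlinger_surface :: "real set \<Rightarrow> (real \<Rightarrow> real^3) \<Rightarrow> (real \<Rightarrow> real^3) \<Rightarrow> bool" where
  "edlinger_surface I s e \<longleftrightarrow>
     (\<forall>u\<in>I. deriv (distribution_parameter s e) u = 0 \<and>
             conical_curvature e u * cot_striction s e u + 1 = 0)"

definition right_helicoid :: "real set \<Rightarrow> (real \<Rightarrow> real^3) \<Rightarrow> (real \<Rightarrow> real^3) \<Rightarrow> bool" where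
  "right_helicoid I s e \<longleftrightarrow>
     (\<forall>u\<in>I. conical_curvature e u = 0 \<and> cot_striction s e u = 0 \<and>
             deriv (distribution_parameter s e) u = 0)"

end

theory Submission
  imports Defs
begin

text \<open>For fixed \<open>u\<close> put \<open>p = \<langle>e, s'\<rangle> = \<delta>\<lambda>\<close>. The hypothesis forces \<open>\<delta>' = 0\<close> by parity in \<open>v\<close>, and in terms
  of \<open>t = w\<^sup>2\<close> it then reads \<open>\<delta>p - kt = f t\<^bsup>(n+1)/2\<^esup> (t + p\<^sup>2)\<close>. Squaring yields a polynomial identity
  in \<open>t\<close>; if \<open>n \<noteq> -1\<close>, comparing orders of vanishing at \<open>t = 0\<close> leaves only \<open>f = 0\<close>. If \<open>n = -1\<close>,
  then \<open>f = -k\<close>, and \<open>p = 0\<close> or \<open>kp = -\<delta>\<close> at every \<open>u\<close>. These two conditions are closed and mutually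
  exclusive, so on the connected interval one of them holds throughout.\<close>

subsection \<open>Curves and frames\<close>

text \<open>With \<open>c = cross3 a b\<close>, the double product
  \<open>cross3 c (cross3 x c)\<close> is the part of \<open>x\<close> orthogonal to
  \<open>c\<close>. Evaluating it by Lagrange's identity directly, and again after expanding the
  inner product \<open>cross3 x c\<close> in \<open>a\<close> and \<open>b\<close>, gives the
  coordinates of \<open>x\<close>.\<close>

lemma orthonormal_cross3_expansion:
  fixes a b x :: "real^3"
  assumes "norm a = 1" "norm b = 1" "inner a b = 0"
  shows "x = inner x a *\<^sub>R a + inner x b *\<^sub>R b + inner x (cross3 a b) *\<^sub>R cross3 a b"
proof -
  define c where "c = cross3 a b"
  have ab: "inner a a = 1" "inner b b = 1" "inner b a = 0"
    using assms by (simp_all add: norm_eq_1 inner_commute)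
  have c1: "inner c c = 1"
    using dot_cross[of a b a b] ab assms by (simp add: c_def)
  have "cross3 x c = inner x b *\<^sub>R a - inner x a *\<^sub>R b"
    unfolding c_def by (rule Lagrange)
  moreover have "cross3 c a = b" "cross3 c b = - a"
    using Lagrange[of a a b] Lagrange[of b a b] ab assms
    by (simp_all add: c_def cross_skew[of "cross3 a b"])
  ultimately have "cross3 c (cross3 x c) = inner x b *\<^sub>R b + inner x a *\<^sub>R a"
    by (simp add: Cross3.right_diff_distrib cross_mult_right)
  moreover have "cross3 c (cross3 x c) = x - inner x c *\<^sub>R c"
    using Lagrange[of c x c] c1 by (simp add: inner_commute)
  ultimately show ?thesis
    by (simp add: c_def algebra_simps)
qed

lemma norm_constant_imp_inner_derivative_eq_0:
  fixes g :: "real \<Rightarrow> 'a::real_inner"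
  assumes "open I" "u \<in> I" "\<And>t. t \<in> I \<Longrightarrow> norm (g t) = r" "(g has_vector_derivative g') (at u)"
  shows "inner (g u) g' = 0"
proof -
  have "((\<lambda>t. inner (g t) (g t)) has_vector_derivative inner (g u) g' + inner g' (g u)) (at u)"
    by (rule bounded_bilinear.has_vector_derivative[OF bounded_bilinear_inner assms(4,4)])
  moreover have "((\<lambda>t. inner (g t) (g t)) has_vector_derivative 0) (at u)"
    by (rule has_vector_derivative_transform_within_open[OF _ assms(1,2), where f = "\<lambda>_. r\<^sup>2"])
      (auto simp: assms(3) simp flip: power2_norm_eq_inner)
  ultimately show ?thesis
    using vector_derivative_unique_at by (fastforce simp: inner_commute)
qed

lemma has_vector_derivative_partial_u:
  assumes "X differentiable (at (u, v))"
  shows "((\<lambda>t. X (t, v)) has_vector_derivative partial_u X (u, v)) (at u)"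
proof -
  have "(X has_derivative frechet_derivative X (at (u, v))) (at (u, v))"
    using assms frechet_derivative_works by blast
  moreover have "((\<lambda>t. (t, v)) has_derivative (\<lambda>h. (h, 0))) (at u)"
    by (auto intro!: derivative_eq_intros)
  ultimately have "((\<lambda>t. X (t, v)) has_derivative
      (\<lambda>h. frechet_derivative X (at (u, v)) (h, 0))) (at u)"
    by (rule has_derivative_compose[rotated])
  moreover have "frechet_derivative X (at (u, v)) (h, 0) = h *\<^sub>R partial_u X (u, v)" for h
    using linear_frechet_derivative[OF assms] linear_cmul[of _ h "(1, 0)"]
    by (fastforce simp: partial_u_def)
  ultimately show ?thesis
    by (simp add: has_vector_derivative_def)
qed

lemma has_vector_derivative_partial_v:
  assumes "X differentiable (at (u, v))"
  shows "((\<lambda>t. X (u, t)) has_vector_derivative partial_v X (u, v)) (at v)"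
proof -
  have "(X has_derivative frechet_derivative X (at (u, v))) (at (u, v))"
    using assms frechet_derivative_works by blast
  moreover have "((\<lambda>t. (u, t)) has_derivative (\<lambda>h. (0, h))) (at v)"
    by (auto intro!: derivative_eq_intros)
  ultimately have "((\<lambda>t. X (u, t)) has_derivative
      (\<lambda>h. frechet_derivative X (at (u, v)) (0, h))) (at v)"
    by (rule has_derivative_compose[rotated])
  moreover have "frechet_derivative X (at (u, v)) (0, h) = h *\<^sub>R partial_v X (u, v)" for h
    using linear_frechet_derivative[OF assms] linear_cmul[of _ h "(0, 1)"]
    by (fastforce simp: partial_v_def)
  ultimately show ?thesis
    by (simp add: has_vector_derivative_def)
qed

subsection \<open>Normal curvature of a skew ruled surface\<close>

text \<open>The direction \<open>(1, 0)\<close> in the recursive clause of \<open>class_C_on\<close>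
  is exactly \<open>partial_u\<close>, so two unfoldings reach the differentiability of the first
  partial derivative.\<close>

lemma differentiable_of_class_C_on:
  assumes "class_C_on (Suc (Suc k)) S X" "p \<in> S"
  shows "X differentiable (at p)" "partial_u X differentiable (at p)"
  using assms by (auto simp: partial_u_def[abs_def])

locale skew_ruled_surface =
  fixes I :: "real set" and s e :: "real \<Rightarrow> real^3"
  assumes skew: "skew_ruled_C3_surface I s e"
begin

abbreviation "k \<equiv> conical_curvature e"
abbreviation "\<delta> \<equiv> distribution_parameter s e"
text \<open>\<open>p\<close> equals \<delta>\<lambda>. Using it in place of \<lambda> keeps the
  cotangent out of the computations until \<open>cot_striction_eq\<close>.\<close>

abbreviation "p u \<equiv> inner (curve_deriv s u) (e u)"

lemma open_I: "open I" and interval_I: "is_interval I"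
  and norm_e: "u \<in> I \<Longrightarrow> norm (e u) = 1"
  and norm_e': "u \<in> I \<Longrightarrow> norm (curve_deriv e u) = 1"
  and inner_s'_e': "u \<in> I \<Longrightarrow> inner (curve_deriv s u) (curve_deriv e u) = 0"
  and \<delta>_nonzero: "u \<in> I \<Longrightarrow> \<delta> u \<noteq> 0"
  using skew by (auto simp: skew_ruled_C3_surface_def)

section \<open>Derivatives of the striction line and of the ruling direction, recovered from the
  parametrization\<close>

lemma differentiable_param:
  assumes "u \<in> I"
  shows "ruled_param s e differentiable (at (u, v))"
    and "partial_u (ruled_param s e) differentiable (at (u, v))"
proof -
  have "class_C_on (Suc (Suc (Suc 0))) (I \<times> UNIV) (ruled_param s e)"
    using skew by (simp add: skew_ruled_C3_surface_def numeral_3_eq_3 del: class_C_on.simps)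
  from differentiable_of_class_C_on[OF this] assms
  show "ruled_param s e differentiable (at (u, v))"
    "partial_u (ruled_param s e) differentiable (at (u, v))"
    by auto
qed

lemma s_has_derivative:
  assumes "u \<in> I"
  shows "(s has_vector_derivative curve_deriv s u) (at u)"
  using has_vector_derivative_partial_u[OF differentiable_param(1)[OF assms, of 0]]
  by (simp add: ruled_param_def vector_derivative_at)

lemma e_has_derivative:
  assumes "u \<in> I"
  shows "(e has_vector_derivative curve_deriv e u) (at u)"
proof -
  \<comment> \<open>Smoothness is assumed of the parametrization only; the difference of the curves
    \<open>v = 1\<close> and \<open>v = 0\<close> isolates \<open>e\<close>. The same device later
    yields the derivative of \<open>e'\<close>.\<close>
  have "((\<lambda>t. ruled_param s e (t, 1) - ruled_param s e (t, 0)) has_vector_derivative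
      partial_u (ruled_param s e) (u, 1) - partial_u (ruled_param s e) (u, 0)) (at u)"
    by (intro has_vector_derivative_diff has_vector_derivative_partial_u
        differentiable_param(1) assms)
  then show ?thesis
    by (simp add: ruled_param_def vector_derivative_at)
qed

lemma partial_u_param:
  assumes "u \<in> I"
  shows "partial_u (ruled_param s e) (u, v) = curve_deriv s u + v *\<^sub>R curve_deriv e u"
proof -
  have "((\<lambda>t. s t + v *\<^sub>R e t) has_vector_derivative
      curve_deriv s u + v *\<^sub>R curve_deriv e u) (at u)"
    using s_has_derivative[OF assms] e_has_derivative[OF assms]
    by (auto intro!: derivative_eq_intros)
  then show ?thesis
    using has_vector_derivative_partial_u[OF differentiable_param(1)[OF assms, of v]]
    by (simp add: ruled_param_def vector_derivative_unique_at)
qed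

lemma partial_v_param:
  assumes "u \<in> I"
  shows "partial_v (ruled_param s e) (u, v) = e u"
proof -
  have "((\<lambda>t. s u + t *\<^sub>R e u) has_vector_derivative e u) (at v)"
    by (auto intro!: derivative_eq_intros)
  then show ?thesis
    using has_vector_derivative_partial_v[OF differentiable_param(1)[OF assms, of v]]
    by (simp add: ruled_param_def vector_derivative_unique_at)
qed

lemma partial_u_param_has_derivative:
  assumes "u \<in> I"
  shows "((\<lambda>t. curve_deriv s t + v *\<^sub>R curve_deriv e t) has_vector_derivative
    partial_u (partial_u (ruled_param s e)) (u, v)) (at u)"
  by (rule has_vector_derivative_transform_within_open[OF _ open_I assms,
        OF has_vector_derivative_partial_u[OF differentiable_param(2)[OF assms, of v]]])
    (simp add: partial_u_param)

lemma s'_has_derivative: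
  assumes "u \<in> I"
  shows "(curve_deriv s has_vector_derivative curve_deriv (curve_deriv s) u) (at u)"
  using partial_u_param_has_derivative[OF assms, of 0] by (simp add: vector_derivative_at)

lemma e'_has_derivative:
  assumes "u \<in> I"
  shows "(curve_deriv e has_vector_derivative curve_deriv (curve_deriv e) u) (at u)"
  using has_vector_derivative_diff[OF partial_u_param_has_derivative[OF assms, of 1]
      partial_u_param_has_derivative[OF assms, of 0]]
  by (simp add: vector_derivative_at)

lemma partial_u_partial_u_param:
  assumes "u \<in> I"
  shows "partial_u (partial_u (ruled_param s e)) (u, v) =
    curve_deriv (curve_deriv s) u + v *\<^sub>R curve_deriv (curve_deriv e) u"
proof -
  have "((\<lambda>t. curve_deriv s t + v *\<^sub>R curve_deriv e t) has_vector_derivative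
      curve_deriv (curve_deriv s) u + v *\<^sub>R curve_deriv (curve_deriv e) u) (at u)"
    using s'_has_derivative[OF assms] e'_has_derivative[OF assms]
    by (auto intro!: derivative_eq_intros)
  then show ?thesis
    using partial_u_param_has_derivative[OF assms, of v] vector_derivative_unique_at by blast
qed

section \<open>Derivative equations of the moving frame e, e', e \<times> e'\<close>

lemma inner_e_e': "u \<in> I \<Longrightarrow> inner (e u) (curve_deriv e u) = 0"
  using norm_constant_imp_inner_derivative_eq_0[OF open_I _ norm_e e_has_derivative] by blast

lemma inner_e'_e'': "u \<in> I \<Longrightarrow> inner (curve_deriv e u) (curve_deriv (curve_deriv e) u) = 0"
  using norm_constant_imp_inner_derivative_eq_0[OF open_I _ norm_e' e'_has_derivative] by blast

lemma \<delta>_eq: "\<delta> u = inner (curve_deriv s u) (cross3 (e u) (curve_deriv e u))"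
  and k_eq: "k u = inner (curve_deriv (curve_deriv e) u) (cross3 (e u) (curve_deriv e u))"
  unfolding distribution_parameter_def conical_curvature_def triple_product_def
  by (metis cross_triple inner_commute)+

text \<open>The striction condition removes the component along e'.\<close>

lemma s'_expansion:
  assumes "u \<in> I"
  shows "curve_deriv s u = p u *\<^sub>R e u + \<delta> u *\<^sub>R cross3 (e u) (curve_deriv e u)"
  using orthonormal_cross3_expansion[OF norm_e norm_e' inner_e_e', OF assms assms assms,
      of "curve_deriv s u"] inner_s'_e'[OF assms]
  by (simp add: \<delta>_eq)

lemma inner_e_e'':
  assumes "u \<in> I"
  shows "inner (e u) (curve_deriv (curve_deriv e) u) = -1"
proof -
  have "((\<lambda>t. inner (e t) (curve_deriv e t)) has_vector_derivative
      inner (e u) (curve_deriv (curve_deriv e) u) + inner (curve_deriv e u) (curve_deriv e u)) (at u)"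
    using bounded_bilinear.has_vector_derivative[OF bounded_bilinear_inner
        e_has_derivative e'_has_derivative] assms by blast
  moreover have "((\<lambda>t. inner (e t) (curve_deriv e t)) has_vector_derivative 0) (at u)"
    by (rule has_vector_derivative_transform_within_open[OF _ open_I assms, where f = "\<lambda>_. 0"])
      (auto simp: inner_e_e')
  ultimately show ?thesis
    using vector_derivative_unique_at norm_e'[OF assms] by (fastforce simp: norm_eq_1)
qed

lemma e''_expansion:
  assumes "u \<in> I"
  shows "curve_deriv (curve_deriv e) u = - e u + k u *\<^sub>R cross3 (e u) (curve_deriv e u)"
  using orthonormal_cross3_expansion[OF norm_e norm_e' inner_e_e', OF assms assms assms,
      of "curve_deriv (curve_deriv e) u"] inner_e'_e''[OF assms] inner_e_e''[OF assms]
  by (simp add: k_eq inner_commute)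

text \<open>Differentiating the striction condition trades s'' for e'', whose frame coordinates are
  known.\<close>

lemma inner_s''_e':
  assumes "u \<in> I"
  shows "inner (curve_deriv (curve_deriv s) u) (curve_deriv e u) = p u - k u * \<delta> u"
proof -
  have "((\<lambda>t. inner (curve_deriv s t) (curve_deriv e t)) has_vector_derivative
      inner (curve_deriv s u) (curve_deriv (curve_deriv e) u) +
      inner (curve_deriv (curve_deriv s) u) (curve_deriv e u)) (at u)"
    using bounded_bilinear.has_vector_derivative[OF bounded_bilinear_inner
        s'_has_derivative e'_has_derivative] assms by blast
  moreover have "((\<lambda>t. inner (curve_deriv s t) (curve_deriv e t)) has_vector_derivative 0) (at u)"
    by (rule has_vector_derivative_transform_within_open[OF _ open_I assms, where f = "\<lambda>_. 0"])
      (auto simp: inner_s'_e')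
  ultimately have "inner (curve_deriv s u) (curve_deriv (curve_deriv e) u) +
      inner (curve_deriv (curve_deriv s) u) (curve_deriv e u) = 0"
    using vector_derivative_unique_at by blast
  then show ?thesis
    by (simp add: e''_expansion[OF assms] inner_diff_right \<delta>_eq)
qed

text \<open>The term e' \<times> e' vanishes, and e \<times> e'' reduces to k times e \<times> (e
  \<times> e') = -e'.\<close>

lemma cross_e_e'_has_derivative:
  assumes "u \<in> I"
  shows "((\<lambda>t. cross3 (e t) (curve_deriv e t)) has_vector_derivative
    - k u *\<^sub>R curve_deriv e u) (at u)"
proof -
  have "bounded_bilinear cross3"
    using bilinear_conv_bounded_bilinear bilinear_cross by blast
  from bounded_bilinear.has_vector_derivative[OF this e_has_derivative[OF assms]
      e'_has_derivative[OF assms]]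
  have "((\<lambda>t. cross3 (e t) (curve_deriv e t)) has_vector_derivative
      cross3 (e u) (curve_deriv (curve_deriv e) u)) (at u)"
    by simp
  moreover have "cross3 (e u) (curve_deriv (curve_deriv e) u) = - k u *\<^sub>R curve_deriv e u"
    using inner_e_e'[OF assms] norm_e[OF assms]
    by (simp add: e''_expansion[OF assms] Cross3.right_diff_distrib cross_mult_right Lagrange norm_eq_1)
  ultimately show ?thesis
    by simp
qed

text \<open>The derivative of e \<times> e' is parallel to e', hence orthogonal to s', so only the
  term with s'' survives.\<close>

lemma \<delta>_has_derivative:
  assumes "u \<in> I"
  shows "(\<delta> has_vector_derivative
    inner (curve_deriv (curve_deriv s) u) (cross3 (e u) (curve_deriv e u))) (at u)"
proof -
  have "\<delta> = (\<lambda>t. inner (curve_deriv s t) (cross3 (e t) (curve_deriv e t)))"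
    by (rule ext) (rule \<delta>_eq)
  then show ?thesis
    using bounded_bilinear.has_vector_derivative[OF bounded_bilinear_inner
        s'_has_derivative[OF assms] cross_e_e'_has_derivative[OF assms]] inner_s'_e'[OF assms]
    by simp
qed

lemma inner_s''_cross:
  assumes "u \<in> I"
  shows "inner (curve_deriv (curve_deriv s) u) (cross3 (e u) (curve_deriv e u)) = deriv \<delta> u"
  using \<delta>_has_derivative[OF assms]
  by (metis DERIV_imp_deriv has_real_derivative_iff_has_vector_derivative)

text \<open>For dv = 0 only the second derivative in u enters the second form. This is the classical
  formula for the normal curvature with \<delta>\<lambda> written as \<open>p\<close>.\<close>

lemma normal_curvature_eq:
  assumes "u \<in> I"
  shows "normal_curvature (ruled_param s e) (u, v) (1, 0) =
    (\<delta> u * (p u - k u * \<delta> u) - v * deriv \<delta> u - v\<^sup>2 * k u) /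
    (sqrt (v\<^sup>2 + (\<delta> u)\<^sup>2) * (v\<^sup>2 + (\<delta> u)\<^sup>2 + (p u)\<^sup>2))"
proof -
  define a b c where "a = e u" and "b = curve_deriv e u" and "c = cross3 a b"
  define s2 where "s2 = curve_deriv (curve_deriv s) u"
  have abc: "inner a a = 1" "inner b b = 1" "inner a b = 0" "inner b a = 0"
    "inner c a = 0" "inner a c = 0" "inner b c = 0" "inner c b = 0"
    using norm_e[OF assms] norm_e'[OF assms] inner_e_e'[OF assms]
    by (simp_all add: a_def b_def c_def norm_eq_1 inner_commute dot_cross_self)
  have cc: "inner c c = 1"
    using dot_cross[of a b a b] abc by (simp add: c_def)
  have ca: "cross3 c a = b"
    using Lagrange[of a a b] abc by (simp add: c_def cross_skew[of "cross3 a b"])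
  have ba: "cross3 b a = - c"
    by (simp add: c_def cross_skew[of b])
  have s1: "curve_deriv s u = p u *\<^sub>R a + \<delta> u *\<^sub>R c"
    unfolding a_def b_def c_def by (rule s'_expansion[OF assms])
  have xu: "partial_u (ruled_param s e) (u, v) = p u *\<^sub>R a + \<delta> u *\<^sub>R c + v *\<^sub>R b"
    using partial_u_param[OF assms, of v] s1 by (simp add: b_def)
  have xv: "partial_v (ruled_param s e) (u, v) = a"
    by (simp add: partial_v_param[OF assms] a_def)
  have xuu: "partial_u (partial_u (ruled_param s e)) (u, v) = s2 + v *\<^sub>R (- a + k u *\<^sub>R c)"
    using partial_u_partial_u_param[OF assms, of v] e''_expansion[OF assms]
    by (simp add: a_def b_def c_def s2_def)
  have s2: "inner s2 b = p u - k u * \<delta> u" "inner s2 c = deriv \<delta> u"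
    using inner_s''_e'[OF assms] inner_s''_cross[OF assms]
    by (simp_all add: s2_def a_def b_def c_def)
  define N where "N = \<delta> u *\<^sub>R b - v *\<^sub>R c"
  have N: "cross3 (partial_u (ruled_param s e) (u, v)) (partial_v (ruled_param s e) (u, v)) = N"
    unfolding xu xv N_def by (simp add: cross_add_left cross_mult_left ca ba)
  have normN: "norm N = sqrt (v\<^sup>2 + (\<delta> u)\<^sup>2)"
    by (simp add: norm_eq_sqrt_inner N_def inner_diff_left inner_diff_right abc cc power2_eq_square)
  \<comment> \<open>\<open>N\<close> has no component along \<open>a\<close>, so the two known
    coordinates of \<open>s2\<close>, along \<open>b\<close> and \<open>c\<close>, suffice.\<close>
  have "inner (s2 + v *\<^sub>R (- a + k u *\<^sub>R c)) N =
      \<delta> u * (p u - k u * \<delta> u) - v * deriv \<delta> u - v\<^sup>2 * k u"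
    by (simp add: N_def inner_diff_left inner_diff_right inner_add_left abc cc s2
        power2_eq_square algebra_simps)
  then have "second_form (ruled_param s e) (u, v) (1, 0) =
      (\<delta> u * (p u - k u * \<delta> u) - v * deriv \<delta> u - v\<^sup>2 * k u) / sqrt (v\<^sup>2 + (\<delta> u)\<^sup>2)"
    by (simp add: second_form_def unit_normal_def N normN xuu divide_inverse mult.commute)
  moreover have "first_form (ruled_param s e) (u, v) (1, 0) = v\<^sup>2 + (\<delta> u)\<^sup>2 + (p u)\<^sup>2"
    by (simp add: first_form_def xu inner_add_left inner_add_right abc cc power2_eq_square)
  ultimately show ?thesis
    by (simp add: normal_curvature_def)
qed

text \<open>The sine of the unsigned angle is |\<delta>| / |s'|, so its cotangent is p / |\<delta>|.
  The sign factor in \<open>striction\<close> and the oddness of the cotangent replace |\<delta>| by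
  \<delta>.\<close>

lemma cot_striction_eq:
  assumes "u \<in> I"
  shows "cot_striction s e u = p u / \<delta> u"
proof -
  define r where "r = norm (curve_deriv s u)"
  have d: "\<delta> u \<noteq> 0"
    by (rule \<delta>_nonzero[OF assms])
  have "r\<^sup>2 = inner (curve_deriv s u) (p u *\<^sub>R e u + \<delta> u *\<^sub>R cross3 (e u) (curve_deriv e u))"
    using s'_expansion[OF assms] by (metis r_def power2_norm_eq_inner)
  then have r2: "r\<^sup>2 = (p u)\<^sup>2 + (\<delta> u)\<^sup>2"
    by (simp add: inner_add_right \<delta>_eq power2_eq_square)
  then have r: "r > 0"
    using d by (metis r_def norm_ge_zero order_le_less power_zero_numeral sum_power2_eq_zero_iff)
  have "\<bar>p u\<bar> \<le> r"
    using r2 r by (metis abs_le_square_iff abs_of_pos le_add_same_cancel1 zero_le_power2)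
  then have bnd: "\<bar>p u / r\<bar> \<le> 1"
    using r by simp
  have "1 - (p u / r)\<^sup>2 = (\<bar>\<delta> u\<bar> / r)\<^sup>2"
    using r diff_divide_distrib[of "r\<^sup>2" "(p u)\<^sup>2" "r\<^sup>2"] r2 d by (simp add: power_divide)
  then have "sqrt (1 - (p u / r)\<^sup>2) = \<bar>\<delta> u\<bar> / r"
    using r by (simp add: real_sqrt_abs)
  then have "cot (arccos (p u / r)) = p u / \<bar>\<delta> u\<bar>"
    using bnd r by (simp add: cot_def sin_arccos_abs cos_arccos_abs)
  moreover have "striction s e u = sgn (\<delta> u) * arccos (p u / r)"
    using norm_e[OF assms] by (simp add: striction_def r_def inner_commute)
  ultimately show ?thesis
    using d by (cases "\<delta> u > 0") (simp_all add: cot_striction_def)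
qed

lemma continuous_on_p: "continuous_on I p"
proof -
  have "continuous_on I (curve_deriv s)" "continuous_on I e"
    using s'_has_derivative e_has_derivative has_vector_derivative_continuous
      continuous_at_imp_continuous_on by blast+
  then show ?thesis
    by (intro continuous_intros)
qed

end

subsection \<open>The pointwise algebraic identity\<close>

text \<open>As v varies, t = v^2 + \<delta>^2 covers only a ray. Equality of polynomials carries
  identities from there to t = 0.\<close>

lemma poly_eqI_on_ray:
  fixes P Q :: "real poly"
  assumes "\<And>t. t \<ge> c \<Longrightarrow> poly P t = poly Q t"
  shows "P = Q"
proof -
  have "infinite {t. poly (P - Q) t = 0}"
    by (rule infinite_super[of "{c..}"]) (use assms infinite_Ici in auto)
  then show ?thesis
    using poly_roots_finite[of "P - Q"] by auto
qed

lemma squared_identity_pos: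
  fixes k f d p c :: real
  assumes "d \<noteq> 0" "m > 0"
    and eq: "\<And>t. t \<ge> c \<Longrightarrow> (d * p - k * t)\<^sup>2 = f\<^sup>2 * t ^ m * (t + p\<^sup>2)\<^sup>2"
  shows "f = 0"
proof -
  have "[:d * p, - k:]\<^sup>2 = smult (f\<^sup>2) (monom 1 m * [:p\<^sup>2, 1:]\<^sup>2)"
    by (rule poly_eqI_on_ray[of c]) (use eq in \<open>simp add: poly_monom algebra_simps\<close>)
  then have all: "(d * p - k * t)\<^sup>2 = f\<^sup>2 * t ^ m * (t + p\<^sup>2)\<^sup>2" for t
    by (drule_tac arg_cong[where f = "\<lambda>P. poly P t"]) (simp add: poly_monom algebra_simps)
  \<comment> \<open>At t = 0 the right side vanishes because \<open>m > 0\<close>, leaving (d p)^2 =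
    0.\<close>
  from all[of 0] assms(1,2) have p: "p = 0"
    by (simp add: power_0_left)
  \<comment> \<open>With p = 0 both sides carry the factor t^2, cancelled here away from 0; the
    polynomial argument then readmits t = 0.\<close>
  have "k\<^sup>2 = f\<^sup>2 * t ^ m" if "t \<ge> 1" for t
    using all[of t] p that by (simp add: power_mult_distrib)
  then have "[:k\<^sup>2:] = smult (f\<^sup>2) (monom 1 m)"
    by (intro poly_eqI_on_ray[of 1]) (simp add: poly_monom)
  then have k: "k\<^sup>2 = f\<^sup>2 * t ^ m" for t
    by (drule_tac arg_cong[where f = "\<lambda>P. poly P t"]) (simp add: poly_monom)
  from k[of 0] k[of 1] assms(2) show ?thesis
    by (simp add: power_0_left)
qed

text \<open>The negative power of t has been moved to the left. If f were nonzero, t = 0 would force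
  p = 0; after cancelling t^2, evaluation at 0 would give f = 0.\<close>

lemma squared_identity_neg:
  fixes k f d p c :: real
  assumes "m > 0"
    and eq: "\<And>t. t \<ge> c \<Longrightarrow> (d * p - k * t)\<^sup>2 * t ^ m = f\<^sup>2 * (t + p\<^sup>2)\<^sup>2"
  shows "f = 0"
proof (rule ccontr)
  assume f: "f \<noteq> 0"
  have "[:d * p, - k:]\<^sup>2 * monom 1 m = smult (f\<^sup>2) ([:p\<^sup>2, 1:]\<^sup>2)"
    by (rule poly_eqI_on_ray[of c]) (use eq in \<open>simp add: poly_monom algebra_simps\<close>)
  then have all: "(d * p - k * t)\<^sup>2 * t ^ m = f\<^sup>2 * (t + p\<^sup>2)\<^sup>2" for t
    by (drule_tac arg_cong[where f = "\<lambda>P. poly P t"]) (simp add: poly_monom algebra_simps)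
  from all[of 0] assms(1) f have p: "p = 0"
    by (simp add: power_0_left)
  have "k\<^sup>2 * t ^ m = f\<^sup>2" if "t \<ge> 1" for t
    using all[of t] p that by (simp add: power_mult_distrib)
  then have "smult (k\<^sup>2) (monom 1 m) = [:f\<^sup>2:]"
    by (intro poly_eqI_on_ray[of 1]) (simp add: poly_monom)
  then have "poly (smult (k\<^sup>2) (monom 1 m)) 0 = f\<^sup>2"
    by simp
  with f assms(1) show False
    by (simp add: poly_monom power_0_left)
qed

lemma pointwise_classification:
  fixes k f d d' p :: real and n :: int
  assumes d: "d \<noteq> 0"
    and eq: "\<And>v. (d * (p - k * d) - v * d' - v\<^sup>2 * k) / (sqrt (v\<^sup>2 + d\<^sup>2) * (v\<^sup>2 + d\<^sup>2 + p\<^sup>2)) =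
      f * sqrt (v\<^sup>2 + d\<^sup>2) powi n"
  shows "d' = 0 \<and> (f = 0 \<and> k = 0 \<and> p = 0 \<or> n = -1 \<and> f = - k \<and> (p = 0 \<or> k * p = - d))"
proof -
  have pos: "v\<^sup>2 + d\<^sup>2 > 0" for v :: real
    using d by (simp add: add_nonneg_pos)
  have lin: "d * (p - k * d) - v * d' - v\<^sup>2 * k =
      f * sqrt (v\<^sup>2 + d\<^sup>2) powi (n + 1) * (v\<^sup>2 + d\<^sup>2 + p\<^sup>2)" for v
  proof -
    have w: "sqrt (v\<^sup>2 + d\<^sup>2) > 0" "v\<^sup>2 + d\<^sup>2 + p\<^sup>2 > 0"
      using pos[of v] by (simp_all add: add_pos_nonneg)
    have "sqrt (v\<^sup>2 + d\<^sup>2) powi (n + 1) = sqrt (v\<^sup>2 + d\<^sup>2) powi n * sqrt (v\<^sup>2 + d\<^sup>2)"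
      using w(1) by (intro power_int_add_1) auto
    moreover have "sqrt (v\<^sup>2 + d\<^sup>2) * (v\<^sup>2 + d\<^sup>2 + p\<^sup>2) \<noteq> 0"
      using w d by simp
    ultimately show ?thesis
      using eq[of v] by (simp only: divide_eq_eq mult.assoc if_True not_False_eq_True if_False)
  qed
  \<comment> \<open>The right side of \<open>lin\<close> is even in v, so the values at 1 and -1
    eliminate everything but the odd term.\<close>
  have d': "d' = 0"
    using lin[of 1] lin[of "-1"] by simp
  \<comment> \<open>Substituting t = v^2 + d^2 absorbs the term k d^2 into k t.\<close>
  have tt: "d * p - k * t = f * sqrt t powi (n + 1) * (t + p\<^sup>2)" if "t \<ge> d\<^sup>2" for t
    using lin[of "sqrt (t - d\<^sup>2)"] d' that by (simp add: power2_eq_square algebra_simps)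
  have zero: ?thesis if "f = 0"
  proof -
    have "d * p - k * d\<^sup>2 = 0" "d * p - k * (d\<^sup>2 + 1) = 0"
      using tt[of "d\<^sup>2"] tt[of "d\<^sup>2 + 1"] that by simp_all
    then have "k = 0"
      by (simp add: distrib_left)
    with \<open>d * p - k * d\<^sup>2 = 0\<close> d d' that show ?thesis
      by simp
  qed
  consider "n = -1" | m where "n + 1 = int m" "m > 0" | m where "n + 1 = - int m" "m > 0"
  proof (cases "n + 1" rule: int_cases2)
    case (nonneg m)
    with that show ?thesis
      by (cases "m = 0") auto
  next
    case (nonpos m)
    with that show ?thesis
      by (cases "m = 0") auto
  qed
  then show ?thesis
  proof cases
    case 1
    \<comment> \<open>For n = -1 the power of w is 1, and both sides are linear in t; comparing
      coefficients gives f = -k and d p = f p^2.\<close>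
    have "[:d * p, - k:] = smult f [:p\<^sup>2, 1:]"
      by (rule poly_eqI_on_ray[of "d\<^sup>2"]) (use tt 1 in \<open>simp add: algebra_simps\<close>)
    then have "f = - k" "d * p = f * p\<^sup>2"
      by simp_all
    then have "p * (k * p + d) = 0"
      by (simp add: power2_eq_square algebra_simps)
    then have "p = 0 \<or> k * p = - d"
      by (simp add: eq_neg_iff_add_eq_0)
    with 1 d' \<open>f = - k\<close> show ?thesis
      by simp
  next
    case (2 m)
    \<comment> \<open>Squaring turns the possibly half-integral power of t into t^m.\<close>
    have "f = 0"
    proof (rule squared_identity_pos[OF d 2(2), of "d\<^sup>2"])
      fix t assume t: "t \<ge> d\<^sup>2"
      have "(sqrt t ^ m)\<^sup>2 = t ^ m"
        using order_trans[OF zero_le_power2 t]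
        by (metis power_mult mult.commute real_sqrt_pow2)
      then show "(d * p - k * t)\<^sup>2 = f\<^sup>2 * t ^ m * (t + p\<^sup>2)\<^sup>2"
        using tt[OF t] 2(1) by (simp add: power_mult_distrib)
    qed
    then show ?thesis
      by (rule zero)
  next
    case (3 m)
    have "f = 0"
    proof (rule squared_identity_neg[OF 3(2), of "d\<^sup>2"])
      fix t assume t: "t \<ge> d\<^sup>2"
      have "t > 0"
        using t d by (meson less_le_trans zero_less_power2)
      have "(sqrt t ^ m)\<^sup>2 = t ^ m"
        using \<open>t > 0\<close> by (metis less_imp_le power_mult mult.commute real_sqrt_pow2)
      then show "(d * p - k * t)\<^sup>2 * t ^ m = f\<^sup>2 * (t + p\<^sup>2)\<^sup>2"
        using tt[OF t] 3(1) \<open>t > 0\<close> by (simp add: power_mult_distrib power_int_minus power_inverse)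
    qed
    then show ?thesis
      by (rule zero)
  qed
qed

section \<open>From the pointwise alternatives to the whole interval\<close>

theorem proposition3:
  fixes I :: "real set" and s e :: "real \<Rightarrow> real^3"
    and f :: "real \<Rightarrow> real" and n :: int
  assumes "skew_ruled_C3_surface I s e"
    and "continuous_on I f"
    and "\<And>u v. u \<in> I \<Longrightarrow>
      normal_curvature (ruled_param s e) (u, v) (1, 0)
        = f u * sqrt (v\<^sup>2 + (distribution_parameter s e u)\<^sup>2) powi n"
  shows "((\<forall>u\<in>I. f u = 0) \<and> right_helicoid I s e) \<or>
    (n = -1 \<and> (\<forall>u\<in>I. f u = - conical_curvature e u) \<and>
      ((orthoid I s e \<and> constant_distribution_parameter I s e) \<or> edlinger_surface I s e))"
proof -
  interpret skew_ruled_surface I s e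
    by unfold_locales (rule assms(1))
  have pw: "deriv \<delta> u = 0 \<and> (f u = 0 \<and> k u = 0 \<and> p u = 0 \<or>
      n = -1 \<and> f u = - k u \<and> (p u = 0 \<or> k u * p u = - \<delta> u))" if "u \<in> I" for u
    using assms(3)[OF that] unfolding normal_curvature_eq[OF that]
    by (rule pointwise_classification[OF \<delta>_nonzero[OF that]])
  show ?thesis
  proof (cases "n = -1")
    case False
    then have "(\<forall>u\<in>I. f u = 0) \<and> right_helicoid I s e"
      using pw by (auto simp: right_helicoid_def cot_striction_eq)
    then show ?thesis ..
  next
    case True
    have fk: "f u = - k u" if "u \<in> I" for u
      using pw[OF that] by auto
    \<comment> \<open>The condition k p = -\<delta> is rewritten with f = -k, because f is
      continuous by assumption; both alternatives thus define relatively closed sets.\<close>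
    have alt: "p u = 0 \<or> f u * p u - \<delta> u = 0" if "u \<in> I" for u
      using pw[OF that] by auto
    have "continuous_on I \<delta>"
      using \<delta>_has_derivative has_vector_derivative_continuous continuous_at_imp_continuous_on
      by blast
    then have "continuous_on I (\<lambda>u. f u * p u - \<delta> u)"
      by (intro continuous_intros continuous_on_p assms(2))
    then have cl: "closedin (top_of_set I) {u \<in> I. p u = 0}"
      "closedin (top_of_set I) {u \<in> I. f u * p u - \<delta> u = 0}"
      by (intro continuous_closedin_preimage_constant continuous_on_p)+
    have "connected I"
      using interval_I by (simp add: is_interval_connected_1)
    moreover have "I \<subseteq> {u \<in> I. p u = 0} \<union> {u \<in> I. f u * p u - \<delta> u = 0}"
      using alt by auto
    \<comment> \<open>A common point would have p = 0 and hence \<delta> = 0, contrary to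
      skewness.\<close>
    moreover have "{u \<in> I. p u = 0} \<inter> {u \<in> I. f u * p u - \<delta> u = 0} = {}"
      using \<delta>_nonzero by auto
    ultimately have "{u \<in> I. p u = 0} = {} \<or> {u \<in> I. f u * p u - \<delta> u = 0} = {}"
      using cl unfolding connected_closedin by blast
    then show ?thesis
    proof
      assume "{u \<in> I. p u = 0} = {}"
      \<comment> \<open>Here k p = -\<delta> throughout; dividing by \<delta> gives k\<lambda> + 1 =
        0.\<close>
      then have "edlinger_surface I s e"
        using alt fk pw \<delta>_nonzero by (fastforce simp: edlinger_surface_def cot_striction_eq field_simps)
      with True fk show ?thesis
        by blast
    next
      assume "{u \<in> I. f u * p u - \<delta> u = 0} = {}"
      \<comment> \<open>Here p = 0 throughout. For n = -1 the right helicoids, with f = 0, also fall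
        under this branch.\<close>
      then have "orthoid I s e \<and> constant_distribution_parameter I s e"
        using alt pw by (auto simp: orthoid_def orthogonal_def inner_commute
            constant_distribution_parameter_def)
      with True fk show ?thesis
        by blast
    qed
  qed
qed

end
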